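(* As formal power series in $x$, $D(-1;x)=F(x)^{-1}$.
   Context: Let $\mathfrak{D}_n$ be the set of derangements of $[n]=\{1,\dots,n\}$, i.e. permutations $\pi=\pi_1\cdots\pi_n$ with $\pi_i\ne i$ for all $i$. An element $i\in[n]$ is an excedance of $\pi$ if $i<\pi_i$; let $\mathsf{exc}(\pi)$ be the number of excedances of $\pi$. Define $D_n(t)=\sum_{\pi\in\mathfrak{D}_n}t^{\mathsf{exc}(\pi)}$ and $D(t;x)=1+\sum_{n=1}^\infty D_n(t)\frac{x^n}{n!}$. Let $f_n=1$ if $n$ is even and $f_n=0$ if $n$ is odd ($n\ge0$), and $F(x)=\sum_{n\ge0}f_n\frac{x^n}{n!}=\cosh(x)$. *)

theory Defs
  imports
    "HOL-Computational_Algebra.Formal_Power_Series"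
    "HOL-Combinatorics.Permutations"
begin

definition derangements :: "nat \<Rightarrow> (nat \<Rightarrow> nat) set" where
  "derangements n = {\<pi>. \<pi> permutes {1..n} \<and> (\<forall>i\<in>{1..n}. \<pi> i \<noteq> i)}"

definition exc :: "nat \<Rightarrow> (nat \<Rightarrow> nat) \<Rightarrow> nat" where
  "exc n \<pi> = card {i \<in> {1..n}. i < \<pi> i}"

(* t ranges over an arbitrary commutative ring, so it can be an indeterminate
   as well as a number such as -1. *)
definition derangement_poly :: "nat \<Rightarrow> 'a::comm_ring_1 \<Rightarrow> 'a" where
  "derangement_poly n t = (\<Sum>\<pi>\<in>derangements n. t ^ exc n \<pi>)"

definition derangement_egf :: "'a::field_char_0 \<Rightarrow> 'a fps" where
  "derangement_egf t =
     Abs_fps (\<lambda>n. if n = 0 then 1 else derangement_poly n t / fact n)"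

definition even_indicator :: "nat \<Rightarrow> 'a::field_char_0" where
  "even_indicator n = (if even n then 1 else 0)"

definition even_egf :: "'a::field_char_0 fps" where
  "even_egf = Abs_fps (\<lambda>n. even_indicator n / fact n)"

lemma even_egf_cosh:
  "even_egf = fps_const (1 / 2) * (fps_exp 1 + fps_exp (- 1) :: 'a::field_char_0 fps)"
  by (rule fps_ext) (auto simp: even_egf_def even_indicator_def field_simps)

end

theory Submission
  imports Defs "HOL-Library.Infinite_Set"
begin

text \<open>
  Splitting a permutation into its fixed points and a derangement of the rest shows that
  \<open>exp (u x) * D(t;x)\<close> is the exponential generating function of permutations weighted by
  \<open>u ^ fix * t ^ exc\<close>. For \<open>u = t\<close> the weight counts weak excedances, for \<open>u = 1\<close> excedances.
  Following a permutation of \<open>{1..n}\<close> by the cycle \<open>i \<mapsto> i + 1\<close> turns every weak excedance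
  into an excedance, except the preimage of \<open>n\<close>, and creates no others. Hence
  \<open>(exp (t x) - t exp x) * D(t;x) = 1 - t\<close>, and \<open>t = -1\<close> gives \<open>2 cosh x * D(-1;x) = 2\<close>.
\<close>

text \<open>Removing the fixed points of a permutation of \<open>{1..n}\<close> leaves a derangement
  of a subset that need not be an interval, hence the general ground set.\<close>

definition derangements_on :: "'a set \<Rightarrow> ('a \<Rightarrow> 'a) set" where
  "derangements_on A = {\<pi>. \<pi> permutes A \<and> (\<forall>i\<in>A. \<pi> i \<noteq> i)}"

definition exc_on :: "'a::linorder set \<Rightarrow> ('a \<Rightarrow> 'a) \<Rightarrow> nat" where
  "exc_on A \<pi> = card {i \<in> A. i < \<pi> i}"

lemma derangement_poly_eq_on:
  "derangement_poly n t = (\<Sum>\<pi>\<in>derangements_on {1..n}. t ^ exc_on {1..n} \<pi>)"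
  by (simp add: derangement_poly_def derangements_def derangements_on_def exc_def exc_on_def)

lemma map_permutation_derangements_on:
  assumes "bij_betw h A B" "\<pi> \<in> derangements_on A"
  shows "map_permutation A h \<pi> \<in> derangements_on B"
proof -
  have perm: "\<pi> permutes A" and nofix: "\<And>i. i \<in> A \<Longrightarrow> \<pi> i \<noteq> i"
    using assms(2) by (auto simp: derangements_on_def)
  have inj: "inj_on h A" and im: "h ` A = B"
    using assms(1) by (auto simp: bij_betw_def)
  have "map_permutation A h \<pi> j \<noteq> j" if "j \<in> B" for j
  proof -
    obtain i where i: "i \<in> A" "j = h i" using \<open>j \<in> B\<close> im by blast
    have "\<pi> i \<in> A" using perm i by (simp add: permutes_in_image)
    then show ?thesis
      using i nofix inj by (simp add: map_permutation_apply inj_on_eq_iff)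
  qed
  then show ?thesis
    using map_permutation_permutes[OF assms(1) perm] by (simp add: derangements_on_def)
qed

lemma exc_on_map_permutation:
  assumes "bij_betw h A B" "strict_mono_on A h" "\<pi> permutes A"
  shows "exc_on B (map_permutation A h \<pi>) = exc_on A \<pi>"
proof -
  have inj: "inj_on h A" and im: "h ` A = B"
    using assms(1) by (auto simp: bij_betw_def)
  have "h i < map_permutation A h \<pi> (h i) \<longleftrightarrow> i < \<pi> i" if "i \<in> A" for i
    using that assms(2,3) inj
    by (simp add: map_permutation_apply strict_mono_on_less permutes_in_image)
  then have "{j \<in> B. j < map_permutation A h \<pi> j} = h ` {i \<in> A. i < \<pi> i}"
    using im by auto
  then show ?thesis
    using inj by (auto simp: exc_on_def intro!: card_image elim: inj_on_subset)
qed

text \<open>Conjugation by \<open>h\<close> is a bijection between the derangements of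
  \<open>A\<close> and of \<open>B\<close>, with conjugation by the inverse of \<open>h\<close>
  undoing it. As \<open>h\<close> is increasing, it preserves \<open>i < \<pi> i\<close> and so the
  weight.\<close>

lemma sum_derangements_on_transfer:
  assumes "bij_betw h A B" "strict_mono_on A h"
  shows "(\<Sum>\<pi>\<in>derangements_on A. t ^ exc_on A \<pi>) = (\<Sum>\<pi>\<in>derangements_on B. t ^ exc_on B \<pi>)"
proof (rule sum.reindex_bij_witness[of _
      "map_permutation B (inv_into A h)" "map_permutation A h"])
  fix \<pi> assume \<pi>: "\<pi> \<in> derangements_on A"
  then have perm: "\<pi> permutes A" by (simp add: derangements_on_def)
  show "map_permutation B (inv_into A h) (map_permutation A h \<pi>) = \<pi>"
    using assms(1) perm
    by (rule map_permutation_compose_inv) (simp add: bij_betw_inv_into_left[OF assms(1)])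
  show "map_permutation A h \<pi> \<in> derangements_on B"
    using assms(1) \<pi> by (rule map_permutation_derangements_on)
  show "t ^ exc_on B (map_permutation A h \<pi>) = t ^ exc_on A \<pi>"
    by (simp add: exc_on_map_permutation[OF assms perm])
next
  have inv: "bij_betw (inv_into A h) B A"
    by (rule bij_betw_inv_into[OF assms(1)])
  fix \<sigma> assume \<sigma>: "\<sigma> \<in> derangements_on B"
  then have perm: "\<sigma> permutes B" by (simp add: derangements_on_def)
  show "map_permutation A h (map_permutation B (inv_into A h) \<sigma>) = \<sigma>"
    using inv perm
    by (rule map_permutation_compose_inv) (simp add: bij_betw_inv_into_right[OF assms(1)])
  show "map_permutation B (inv_into A h) \<sigma> \<in> derangements_on A"
    using inv \<sigma> by (rule map_permutation_derangements_on)
qed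

lemma sum_derangements_on:
  fixes A :: "nat set" and t :: "'a::comm_ring_1"
  assumes "finite A"
  shows "(\<Sum>\<pi>\<in>derangements_on A. t ^ exc_on A \<pi>) = derangement_poly (card A) t"
proof -
  let ?n = "card A"
  obtain h where h: "bij_betw h {..<?n} A" "strict_mono_on {..<?n} h"
    using ex_bij_betw_strict_mono_card[OF assms] by blast
  \<comment> \<open>The increasing enumeration \<open>h\<close> of \<open>A\<close> counts from 0,
    while \<open>derangement_poly\<close> lives on \<open>{1..n}\<close>; the shift
    \<open>Suc\<close> reconciles the two.\<close>
  have S: "bij_betw Suc {..<?n} {1..?n}"
    by (auto simp: bij_betw_def image_Suc_lessThan)
  have "strict_mono_on {..<?n} Suc"
    by (simp add: strict_mono_on_def)
  from sum_derangements_on_transfer[OF S this, of t] sum_derangements_on_transfer[OF h, of t]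
  show ?thesis by (simp add: derangement_poly_eq_on)
qed

lemma sum_Pow_card:
  fixes g :: "nat \<Rightarrow> 'a::comm_semiring_1"
  assumes "finite A"
  shows "(\<Sum>F\<in>Pow A. g (card F)) = (\<Sum>k\<le>card A. of_nat (card A choose k) * g k)"
proof -
  have "(\<Sum>F\<in>Pow A. g (card F))
      = (\<Sum>k\<le>card A. \<Sum>F | F \<in> Pow A \<and> card F = k. g (card F))"
    using assms by (intro sum.group[symmetric]) (auto intro: card_mono)
  also have "\<dots> = (\<Sum>k\<le>card A. of_nat (card A choose k) * g k)"
    using n_subsets[OF assms] by (intro sum.cong) auto
  finally show ?thesis .
qed

text \<open>A function that permutes \<open>A - F\<close> is already the identity on
  \<open>F\<close>, so the same function is read on both sides and no restriction map is
  needed.\<close>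

lemma derangements_on_Diff:
  assumes "F \<subseteq> A"
  shows "derangements_on (A - F) = {\<pi>. \<pi> permutes A \<and> {i \<in> A. \<pi> i = i} = F}"
proof (intro equalityI subsetI)
  fix \<pi> assume "\<pi> \<in> derangements_on (A - F)"
  then have perm: "\<pi> permutes (A - F)" and nofix: "\<And>i. i \<in> A - F \<Longrightarrow> \<pi> i \<noteq> i"
    by (auto simp: derangements_on_def)
  have "\<pi> permutes A" using perm by (rule permutes_subset) auto
  moreover have "\<pi> i = i" if "i \<in> F" for i
    using perm that by (simp add: permutes_not_in)
  ultimately show "\<pi> \<in> {\<pi>. \<pi> permutes A \<and> {i \<in> A. \<pi> i = i} = F}"
    using nofix assms by blast
next
  fix \<pi> assume "\<pi> \<in> {\<pi>. \<pi> permutes A \<and> {i \<in> A. \<pi> i = i} = F}"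
  then have perm: "\<pi> permutes A" and fixed: "{i \<in> A. \<pi> i = i} = F" by auto
  have "\<pi> permutes (A - F)"
    using perm by (rule permutes_superset) (use fixed in auto)
  then show "\<pi> \<in> derangements_on (A - F)"
    using fixed by (auto simp: derangements_on_def)
qed

text \<open>Permutations are classified by their set \<open>F\<close> of fixed points. Each class
  contributes an amount that depends only on \<open>card F\<close>, and the binomial coefficient
  counts the sets of that size.\<close>

lemma sum_permutations_fixed_exc:
  fixes A :: "nat set" and t u :: "'a::comm_ring_1"
  assumes "finite A"
  shows "(\<Sum>\<pi> | \<pi> permutes A. u ^ card {i \<in> A. \<pi> i = i} * t ^ exc_on A \<pi>)
       = (\<Sum>k\<le>card A. of_nat (card A choose k) * (u ^ k * derangement_poly (card A - k) t))"
proof -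
  let ?w = "\<lambda>\<pi>. u ^ card {i \<in> A. \<pi> i = i} * t ^ exc_on A \<pi>"
  have block: "(\<Sum>\<pi> | \<pi> permutes A \<and> {i \<in> A. \<pi> i = i} = F. ?w \<pi>)
      = u ^ card F * derangement_poly (card A - card F) t" if "F \<subseteq> A" for F
  proof -
    have "(\<Sum>\<pi> | \<pi> permutes A \<and> {i \<in> A. \<pi> i = i} = F. ?w \<pi>)
        = (\<Sum>\<pi>\<in>derangements_on (A - F). u ^ card F * t ^ exc_on (A - F) \<pi>)"
      unfolding derangements_on_Diff[OF that]
    proof (intro sum.cong refl)
      fix \<pi> assume \<pi>: "\<pi> \<in> {\<pi>. \<pi> permutes A \<and> {i \<in> A. \<pi> i = i} = F}"
      \<comment> \<open>A fixed point is never an excedance, so discarding \<open>F\<close> loses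
        none.\<close>
      then have "{i \<in> A. i < \<pi> i} = {i \<in> A - F. i < \<pi> i}" by force
      with \<pi> show "?w \<pi> = u ^ card F * t ^ exc_on (A - F) \<pi>"
        by (simp add: exc_on_def)
    qed
    also have "\<dots> = u ^ card F * derangement_poly (card A - card F) t"
      using assms that
      by (simp add: sum_distrib_left[symmetric] sum_derangements_on card_Diff_subset finite_subset)
    finally show ?thesis .
  qed
  have "sum ?w {\<pi>. \<pi> permutes A}
      = (\<Sum>F\<in>Pow A. \<Sum>\<pi> | \<pi> \<in> {\<pi>. \<pi> permutes A} \<and> {i \<in> A. \<pi> i = i} = F. ?w \<pi>)"
    using assms by (intro sum.group[symmetric]) (auto intro: finite_permutations)
  also have "\<dots> = (\<Sum>F\<in>Pow A. u ^ card F * derangement_poly (card A - card F) t)"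
    using block by (intro sum.cong) auto
  also have "\<dots> = (\<Sum>k\<le>card A. of_nat (card A choose k) * (u ^ k * derangement_poly (card A - k) t))"
    using sum_Pow_card[OF assms, of "\<lambda>k. u ^ k * derangement_poly (card A - k) t"] .
  finally show ?thesis .
qed

text \<open>For \<open>n > 0\<close> the last branch only concerns points outside
  \<open>{1..n}\<close>, which \<open>permutes\<close> requires to be fixed.\<close>

definition rotate_up :: "nat \<Rightarrow> nat \<Rightarrow> nat" where
  "rotate_up n i = (if i \<in> {1..<n} then Suc i else if i = n then 1 else i)"

lemma rotate_up_permutes:
  assumes "n > 0"
  shows "rotate_up n permutes {1..n}"
proof (rule bij_imp_permutes)
  have "inj_on (rotate_up n) {1..n}"
    by (auto simp: inj_on_def rotate_up_def split: if_splits)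
  moreover have "rotate_up n ` {1..n} \<subseteq> {1..n}"
    using assms by (auto simp: rotate_up_def)
  ultimately show "bij_betw (rotate_up n) {1..n} {1..n}"
    by (simp add: bij_betw_def endo_inj_surj)
qed (use assms in \<open>auto simp: rotate_up_def\<close>)

text \<open>For \<open>\<pi> i < n\<close> the new value is \<open>\<pi> i + 1\<close>, and
  \<open>i < \<pi> i + 1\<close> says \<open>i \<le> \<pi> i\<close>. The preimage \<open>m\<close>
  of \<open>n\<close> is sent to 1, which exceeds no element of \<open>{1..n}\<close>.\<close>

lemma exc_on_rotate_up:
  assumes "n > 0" "\<pi> permutes {1..n}"
  shows "Suc (exc_on {1..n} (rotate_up n \<circ> \<pi>)) = card {i \<in> {1..n}. \<pi> i = i} + exc_on {1..n} \<pi>"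
proof -
  let ?W = "{i \<in> {1..n}. i \<le> \<pi> i}"
  obtain m where m: "m \<in> {1..n}" "\<pi> m = n"
    using assms permutes_image[OF assms(2)]
    by (metis atLeastAtMost_iff imageE le_refl Suc_leI One_nat_def)
  have in_range: "\<pi> i \<in> {1..n}" if "i \<in> {1..n}" for i
    using assms(2) that permutes_in_image by metis
  have inj: "\<pi> i = n \<longleftrightarrow> i = m" for i
    using m permutes_inj[OF assms(2)] by (metis injD)
  have "{i \<in> {1..n}. i < (rotate_up n \<circ> \<pi>) i} = ?W - {m}"
  proof -
    have "i < rotate_up n (\<pi> i) \<longleftrightarrow> i \<le> \<pi> i \<and> i \<noteq> m" if "i \<in> {1..n}" for i
      using in_range[OF that] inj[of i] that by (auto simp: rotate_up_def)
    then show ?thesis by auto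
  qed
  \<comment> \<open>Since \<open>m \<le> n = \<pi> m\<close>, exactly one weak excedance is lost;
    this is the \<open>Suc\<close> of the claim.\<close>
  moreover have "m \<in> ?W" using m by simp
  ultimately have "Suc (exc_on {1..n} (rotate_up n \<circ> \<pi>)) = card ?W"
    by (simp only: exc_on_def) (rule card.remove[symmetric], auto)
  also have "?W = {i \<in> {1..n}. \<pi> i = i} \<union> {i \<in> {1..n}. i < \<pi> i}" by force
  also have "card \<dots> = card {i \<in> {1..n}. \<pi> i = i} + exc_on {1..n} \<pi>"
    unfolding exc_on_def by (rule card_Un_disjoint) auto
  finally show ?thesis .
qed

lemma sum_permutations_weak_exc:
  fixes t :: "'a::comm_ring_1" and n :: nat
  assumes "n > 0"
  shows "(\<Sum>\<pi> | \<pi> permutes {1..n}. t ^ card {i \<in> {1..n}. \<pi> i = i} * t ^ exc_on {1..n} \<pi>)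
       = t * (\<Sum>\<pi> | \<pi> permutes {1..n}. t ^ exc_on {1..n} \<pi>)"
proof -
  have "t * (\<Sum>\<pi> | \<pi> permutes {1..n}. t ^ exc_on {1..n} \<pi>)
      = t * (\<Sum>\<pi> | \<pi> permutes {1..n}. t ^ exc_on {1..n} (rotate_up n \<circ> \<pi>))"
    \<comment> \<open>Composing with a fixed permutation on the left only reorders the sum over all
      permutations.\<close>
    by (rule arg_cong[OF setum_permutations_compose_left[OF rotate_up_permutes[OF assms]]])
  also have "\<dots> = (\<Sum>\<pi> | \<pi> permutes {1..n}. t ^ Suc (exc_on {1..n} (rotate_up n \<circ> \<pi>)))"
    by (simp only: sum_distrib_left power_Suc)
  also have "\<dots> = (\<Sum>\<pi> | \<pi> permutes {1..n}.
      t ^ card {i \<in> {1..n}. \<pi> i = i} * t ^ exc_on {1..n} \<pi>)"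
    by (intro sum.cong refl) (simp only: mem_Collect_eq exc_on_rotate_up[OF assms] power_add)
  finally show ?thesis by (rule sym)
qed

text \<open>The empty permutation is a derangement without excedances. Thus the separate value 1 at
  index 0 in \<open>derangement_egf\<close> fits the general formula.\<close>

lemma derangement_poly_0: "derangement_poly 0 t = 1"
  by (simp add: derangement_poly_def derangements_def exc_def)

lemma fps_exp_mult_derangement_egf_nth:
  fixes t u :: "'a::field_char_0"
  shows "fps_nth (fps_exp u * derangement_egf t) n
       = (\<Sum>\<pi> | \<pi> permutes {1..n}. u ^ card {i \<in> {1..n}. \<pi> i = i} * t ^ exc_on {1..n} \<pi>) / fact n"
proof -
  have egf_nth: "fps_nth (derangement_egf t) k = derangement_poly k t / fact k" for k
    by (simp add: derangement_egf_def derangement_poly_0)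
  have "fps_nth (fps_exp u * derangement_egf t) n
      = (\<Sum>k\<le>n. of_nat (n choose k) * (u ^ k * derangement_poly (n - k) t) / fact n)"
    by (auto simp: fps_mult_nth egf_nth atLeast0AtMost binomial_fact intro!: sum.cong)
  then show ?thesis
    using sum_permutations_fixed_exc[of "{1..n}" u t] by (simp add: sum_divide_distrib)
qed

lemma derangement_egf_equation:
  fixes t :: "'a::field_char_0"
  shows "(fps_exp t - fps_const t * fps_exp 1) * derangement_egf t = fps_const (1 - t)"
proof (rule fps_ext)
  fix n
  have "fps_nth ((fps_exp t - fps_const t * fps_exp 1) * derangement_egf t) n
      = fps_nth (fps_exp t * derangement_egf t) n - t * fps_nth (fps_exp 1 * derangement_egf t) n"
    by (simp add: left_diff_distrib mult.assoc)
  also have "\<dots> = fps_nth (fps_const (1 - t)) n"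
  proof (cases "n = 0")
    case True
    \<comment> \<open>The weak excedance identity needs \<open>n > 0\<close>; the constant terms
      alone survive and give \<open>1 - t\<close>.\<close>
    then show ?thesis by (simp add: derangement_egf_def)
  next
    case False
    then show ?thesis
      using sum_permutations_weak_exc[of n t]
      by (simp add: fps_exp_mult_derangement_egf_nth)
  qed
  finally show "fps_nth ((fps_exp t - fps_const t * fps_exp 1) * derangement_egf t) n
      = fps_nth (fps_const (1 - t)) n" .
qed

theorem corollary10:
  shows "derangement_egf (- 1) = inverse (even_egf :: 'a::field_char_0 fps)"
proof -
  have "even_egf * derangement_egf (- 1 :: 'a)
      = fps_const (1 / 2) * ((fps_exp (- 1) - fps_const (- 1) * fps_exp 1) * derangement_egf (- 1))"
    \<comment> \<open>At \<open>t = -1\<close> the factor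
      \<open>fps_exp t - fps_const t * fps_exp 1\<close> becomes a sum of two exponentials, which is
      twice \<open>even_egf\<close>.\<close>
    by (simp add: even_egf_cosh algebra_simps flip: fps_const_neg)
  also have "\<dots> = fps_const (1 / 2) * fps_const (1 - (- 1))"
    by (simp only: derangement_egf_equation)
  also have "\<dots> = 1"
    by (simp only: fps_const_mult) simp
  finally show ?thesis
    by (metis fps_inverse_unique)
qed

end
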